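(* The difference $\chi_{=}(G)-L(G)$ is unbounded on connected block graphs; that is, for every integer $C$ there is a connected block graph $G$ with $\chi_{=}(G)-L(G)> C$.
   Context: All graphs are finite and simple, and all numbers of colors are positive integers. An equitable $q$-coloring of a graph $G$ is a proper vertex coloring with $q$ colors in which every color class has size $\lfloor |V(G)|/q\rfloor$ or $\lceil |V(G)|/q\rceil$. The equitable chromatic number $\chi_{=}(G)$ is the least $q$ for which $G$ has an equitable $q$-coloring. For $v\in V(G)$ let $\alpha(G,v)=\max\{|I| : I\subseteq V(G)\text{ is independent and } v\in I\}$, and let $\alpha_{\min}(G)=\min_{v\in V(G)}\alpha(G,v)$. With $\omega(G)$ denoting the clique number, let $L(G)=\max\left\{\omega(G),\left\lceil \frac{|V(G)|+1}{\alpha_{\min}(G)+1}\right\rceil\right\}$. A block graph is a graph all of whose blocks are cliques (complete graphs), where a block is a maximal connected subgraph having no cut vertex of its own. *)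

theory Defs
  imports Complex_Main "Graph_Theory.Graph_Theory"
begin

text \<open>
  A finite simple graph is an irreflexive symmetric digraph without parallel arcs
  (locale \<^locale>\<open>graph\<close>, or \<^locale>\<open>pair_graph\<close> when the arcs are literally pairs):
  an edge \<open>uv\<close> is the pair of arcs \<open>(u, v)\<close>, \<open>(v, u)\<close>.
\<close>

definition independent_set :: "('a, 'b) pre_digraph \<Rightarrow> 'a set \<Rightarrow> bool" where
  "independent_set G I \<longleftrightarrow> I \<subseteq> verts G \<and> (\<forall>u\<in>I. \<forall>v\<in>I. \<not> u \<rightarrow>\<^bsub>G\<^esub> v)"

definition clique_set :: "('a, 'b) pre_digraph \<Rightarrow> 'a set \<Rightarrow> bool" where
  "clique_set G K \<longleftrightarrow> K \<subseteq> verts G \<and> (\<forall>u\<in>K. \<forall>v\<in>K. u \<noteq> v \<longrightarrow> u \<rightarrow>\<^bsub>G\<^esub> v)"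

definition clique_number :: "('a, 'b) pre_digraph \<Rightarrow> nat" where
  "clique_number G = Max {card K | K. clique_set G K}"

definition alpha_at :: "('a, 'b) pre_digraph \<Rightarrow> 'a \<Rightarrow> nat" where
  "alpha_at G v = Max {card I | I. independent_set G I \<and> v \<in> I}"

definition alpha_min :: "('a, 'b) pre_digraph \<Rightarrow> nat" where
  "alpha_min G = Min (alpha_at G ` verts G)"

definition lower_bound :: "('a, 'b) pre_digraph \<Rightarrow> nat" where
  "lower_bound G = max (clique_number G)
     (nat \<lceil>(real (card (verts G)) + 1) / (real (alpha_min G) + 1)\<rceil>)"

definition proper_coloring :: "('a, 'b) pre_digraph \<Rightarrow> nat \<Rightarrow> ('a \<Rightarrow> nat) \<Rightarrow> bool" where
  "proper_coloring G q c \<longleftrightarrow>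
     (\<forall>v\<in>verts G. c v < q) \<and> (\<forall>u\<in>verts G. \<forall>v\<in>verts G. u \<rightarrow>\<^bsub>G\<^esub> v \<longrightarrow> c u \<noteq> c v)"

text \<open>Color classes may be empty, which happens exactly when \<open>q\<close> exceeds the number of vertices.\<close>

definition equitable_coloring :: "('a, 'b) pre_digraph \<Rightarrow> nat \<Rightarrow> ('a \<Rightarrow> nat) \<Rightarrow> bool" where
  "equitable_coloring G q c \<longleftrightarrow> proper_coloring G q c \<and>
     (\<forall>i<q. int (card {v \<in> verts G. c v = i}) \<in>
        {\<lfloor>real (card (verts G)) / real q\<rfloor>, \<lceil>real (card (verts G)) / real q\<rceil>})"

definition equitable_chromatic_number :: "('a, 'b) pre_digraph \<Rightarrow> nat" where
  "equitable_chromatic_number G = (LEAST q. q > 0 \<and> (\<exists>c. equitable_coloring G q c))"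

text \<open>
  A cut vertex separates two other vertices of the same component. In particular the
  only vertex of a one-vertex graph is not a cut vertex (the library's
  \<^const>\<open>Digraph_Component.connected\<close> is false for the graph without vertices).
\<close>

definition cut_vertex :: "('a, 'b) pre_digraph \<Rightarrow> 'a \<Rightarrow> bool" where
  "cut_vertex G v \<longleftrightarrow> v \<in> verts G \<and>
     (\<exists>x\<in>verts G - {v}. \<exists>y\<in>verts G - {v}.
        x \<rightarrow>\<^sup>*\<^bsub>G\<^esub> y \<and> \<not> x \<rightarrow>\<^sup>*\<^bsub>pre_digraph.del_vert G v\<^esub> y)"

text \<open>
  The condition \<open>Digraph.graph H\<close> restricts to symmetric subdigraphs, i.e. to subgraphs of
  the undirected graph.
\<close>

definition block :: "('a, 'b) pre_digraph \<Rightarrow> ('a, 'b) pre_digraph \<Rightarrow> bool" where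
  "block G B \<longleftrightarrow> pre_digraph.max_subgraph G
     (\<lambda>H. Digraph.graph H \<and> Digraph_Component.connected H \<and> (\<forall>v. \<not> cut_vertex H v)) B"

definition block_graph :: "('a, 'b) pre_digraph \<Rightarrow> bool" where
  "block_graph G \<longleftrightarrow> Digraph.graph G \<and> (\<forall>B. block G B \<longrightarrow> (\<exists>n. complete_digraph n B))"

end

theory Submission
  imports Defs
begin

text \<open>
  The witness is a triangle of three hubs; on each hub hang one leaf and four cliques of \<open>s\<close>
  vertices, every vertex of which is joined to that hub. It has \<open>n = 12 s + 6\<close> vertices.

  The bound \<open>L\<close> looks at one vertex at a time. A hub loses only its own five pendant cliques, so
  it still lies in an independent set of size \<open>1 + 10 = 11\<close>, the other vertices do no worse, and
  \<open>(n + 1) / 12 = s + 7 / 12\<close>; the largest clique has \<open>s + 1\<close> vertices. Hence \<open>L \<le> s + 1\<close>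
  (\<open>lower_bound_limbed_triangle_le\<close>).

  What \<open>L\<close> does not see is that the three hubs need three different colors, whose classes
  compete for the same vertices. Of the three hub colors, a pendant clique can show only the two
  that differ from its own hub's color, each at most once. For one color alone this costs
  just the cliques at one hub. The three classes together, however, each could use ten of the
  fifteen pendant cliques, but a leaf has room for only one of its two candidates. So the three
  classes together cover at most \<open>3 + 3 * 1 + 12 * 2 = 30\<close> vertices
  (\<open>card_three_hub_classes_le\<close>), and some class has at most 10. If there are \<open>q\<close> colors, an
  equitable coloring therefore forces \<open>n div q \<le> 10\<close>, that is \<open>12 s + 6 < 11 q\<close>: the number of
  colors exceeds \<open>s\<close> by the factor \<open>12 / 11\<close>, and the gap to \<open>s + 1\<close> grows linearly in \<open>s\<close>.

  Every pendant clique is separated from the rest by its hub, so the blocks are the triangle and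
  the pendant cliques together with their hubs.
\<close>

section \<open>Block graphs\<close>

lemma reachable_closed:
  assumes "x \<rightarrow>\<^sup>*\<^bsub>D\<^esub> y" "x \<in> S" "\<And>u w. u \<rightarrow>\<^bsub>D\<^esub> w \<Longrightarrow> u \<in> S \<Longrightarrow> w \<in> S"
  shows "y \<in> S"
proof -
  have "(x, y) \<in> (arcs_ends D)\<^sup>*"
    using assms(1) by (rule reachable_rtranclI)
  then show ?thesis
    using assms(2,3) by induction auto
qed

lemma connected_graph_reachable:
  assumes "Digraph.graph H" "Digraph_Component.connected H" "x \<in> verts H" "y \<in> verts H"
  shows "x \<rightarrow>\<^sup>*\<^bsub>H\<^esub> y"
proof -
  interpret Digraph.graph H by fact
  show ?thesis
    using symmetric_connected_imp_strongly_connected[OF sym_arcs assms(2)] assms(3,4)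
    by (auto simp: strongly_connected_def)
qed

text \<open>
  If every arc that leaves \<open>S\<close> ends in \<open>h\<close>, then deleting \<open>h\<close> makes \<open>S\<close> closed under arcs. The
  vertex \<open>h\<close> belongs to the graph because otherwise \<open>S\<close> would be closed already,
  against connectedness.
\<close>

lemma cut_vertex_if_gate:
  assumes H: "Digraph.graph H" "Digraph_Component.connected H"
    and x: "x \<in> verts H" "x \<in> S" and y: "y \<in> verts H" "y \<notin> S" "y \<noteq> h" and h: "h \<notin> S"
    and gate: "\<And>u w. u \<rightarrow>\<^bsub>H\<^esub> w \<Longrightarrow> u \<in> S \<Longrightarrow> w \<in> S \<or> w = h"
  shows "cut_vertex H h"
proof -
  interpret Digraph.graph H by fact
  have xy: "x \<rightarrow>\<^sup>*\<^bsub>H\<^esub> y"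
    using H x(1) y(1) by (rule connected_graph_reachable)
  have "h \<in> verts H"
  proof (rule ccontr)
    assume "h \<notin> verts H"
    then have "w \<in> S" if "u \<rightarrow>\<^bsub>H\<^esub> w" "u \<in> S" for u w
      using gate[OF that] adj_in_verts(2)[OF that(1)] by auto
    with xy x(2) have "y \<in> S"
      by (rule reachable_closed)
    with y(2) show False by simp
  qed
  moreover have "\<not> x \<rightarrow>\<^sup>*\<^bsub>pre_digraph.del_vert H h\<^esub> y"
  proof
    assume *: "x \<rightarrow>\<^sup>*\<^bsub>pre_digraph.del_vert H h\<^esub> y"
    have "w \<in> S" if "u \<rightarrow>\<^bsub>pre_digraph.del_vert H h\<^esub> w" "u \<in> S" for u w
    proof -
      have "u \<rightarrow>\<^bsub>H\<^esub> w" "w \<noteq> h"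
        using that(1) by (auto simp: arcs_ends_conv del_vert_simps)
      then show ?thesis
        using gate[of u w] that(2) by blast
    qed
    with * x(2) have "y \<in> S"
      by (rule reachable_closed)
    with y(2) show False by simp
  qed
  ultimately show ?thesis
    using xy x y h unfolding cut_vertex_def by blast
qed

lemma cut_vertex_not_complete:
  assumes "Digraph.graph H" "clique_set H (verts H)"
  shows "\<not> cut_vertex H v"
proof -
  interpret Digraph.graph H by fact
  interpret D: wf_digraph "del_vert v"
    by (rule wf_digraph_del_vert)
  have "x \<rightarrow>\<^sup>*\<^bsub>del_vert v\<^esub> y" if "x \<in> verts H - {v}" "y \<in> verts H - {v}" for x y
  proof (cases "x = y")
    case True
    then show ?thesis
      using that by (auto simp: del_vert_simps)
  next
    case False
    then have "x \<rightarrow>\<^bsub>H\<^esub> y"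
      using that assms(2) by (auto simp: clique_set_def)
    then have "x \<rightarrow>\<^bsub>del_vert v\<^esub> y"
      using that by (auto simp: arcs_ends_conv del_vert_simps)
    then show ?thesis by simp
  qed
  then show ?thesis
    by (auto simp: cut_vertex_def)
qed

text \<open>
  If a block \<open>B\<close> spans a clique of \<open>G\<close>, then the subgraph induced by its vertices is complete, hence
  connected without cut vertex; since it contains \<open>B\<close>, maximality makes it equal to \<open>B\<close>.
\<close>

lemma block_graphI:
  fixes G :: "('a, 'b) pre_digraph"
  assumes G: "Digraph.graph G"
    and clique: "\<And>H. \<lbrakk>subgraph H G; Digraph.graph H; Digraph_Component.connected H;
      \<forall>v. \<not> cut_vertex H v\<rbrakk> \<Longrightarrow> clique_set G (verts H)"
  shows "block_graph G"
  unfolding block_graph_def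
proof (intro conjI allI impI G)
  fix B assume "block G B"
  interpret Digraph.graph G by fact
  define P where "P = (\<lambda>H :: ('a, 'b) pre_digraph. Digraph.graph H \<and>
      Digraph_Component.connected H \<and> (\<forall>v. \<not> cut_vertex H v))"
  have max: "max_subgraph P B"
    using \<open>block G B\<close> by (simp add: block_def P_def)
  then have sub: "subgraph B G" and "P B"
    by (auto simp: max_subgraph_def)
  then have BG: "verts B \<subseteq> verts G" and conn: "Digraph_Component.connected B"
    and K: "clique_set G (verts B)"
    using clique by (auto simp: P_def)
  let ?B = "G \<restriction> verts B"
  have subB: "subgraph ?B G"
    using BG by (rule subgraph_induce_subgraphI)
  have gB: "Digraph.graph ?B"
  proof -
    interpret d: digraph ?B
      using subB by (rule digraph_subgraph)
    show ?thesis
      using induced_graph_imp_symmetric[OF sym_arcs induced_induce[OF BG]] by blast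
  qed
  interpret B: Digraph.graph ?B by (rule gB)
  have adj: "x \<rightarrow>\<^bsub>?B\<^esub> y" if xy: "x \<in> verts B" "y \<in> verts B" "x \<noteq> y" for x y
  proof -
    have "x \<rightarrow>\<^bsub>G\<^esub> y"
      using K xy by (auto simp: clique_set_def)
    then obtain e where "e \<in> arcs G" "tail G e = x" "head G e = y"
      by (rule reachableE)
    with xy show ?thesis
      by (force simp: arcs_ends_conv)
  qed
  have "Digraph_Component.connected ?B"
  proof (rule B.connectedI)
    show "verts ?B \<noteq> {}"
      using conn by (auto simp: Digraph_Component.connected_def strongly_connected_def)
    fix u v assume "u \<in> verts ?B" "v \<in> verts ?B"
    then show "u \<rightarrow>\<^sup>*\<^bsub>mk_symmetric ?B\<^esub> v"
      using adj by (cases "u = v") (auto intro: B.reachable_mk_symmetricI)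
  qed
  moreover have "clique_set ?B (verts ?B)"
    using adj by (auto simp: clique_set_def)
  ultimately have "P ?B"
    using gB cut_vertex_not_complete[OF gB] by (auto simp: P_def)
  then have "B = ?B"
    using max subB subgraph_induce_subgraphI2[OF sub] unfolding max_subgraph_def by metis
  have "complete_digraph (card (verts B)) ?B"
  proof -
    have "u \<rightarrow>\<^bsub>?B\<^esub> v \<longleftrightarrow> u \<in> verts B \<and> v \<in> verts B \<and> u \<noteq> v" for u v
      using adj[of u v] B.adj_in_verts[of u v] B.adj_not_same[of u] by auto
    then show ?thesis
      unfolding complete_digraph_def using gB by auto
  qed
  with \<open>B = ?B\<close> show "\<exists>n. complete_digraph n B" by metis
qed

section \<open>The numerical invariants\<close>

lemma card_independent_le_alpha_at:
  assumes "finite (verts G)" "independent_set G I" "v \<in> I"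
  shows "card I \<le> alpha_at G v"
proof -
  have "{card I | I. independent_set G I \<and> v \<in> I} \<subseteq> card ` Pow (verts G)"
    by (auto simp: independent_set_def)
  then have "finite {card I | I. independent_set G I \<and> v \<in> I}"
    using assms(1) by (meson finite_Pow_iff finite_imageI finite_subset)
  then show ?thesis
    unfolding alpha_at_def using assms(2,3) by (intro Max_ge) auto
qed

lemma clique_number_le:
  assumes "finite (verts G)" "\<And>K. clique_set G K \<Longrightarrow> card K \<le> k"
  shows "clique_number G \<le> k"
proof -
  have "{card K | K. clique_set G K} \<subseteq> card ` Pow (verts G)"
    by (auto simp: clique_set_def)
  then have "finite {card K | K. clique_set G K}"
    using assms(1) by (meson finite_Pow_iff finite_imageI finite_subset)
  moreover have "clique_set G {}"
    by (simp add: clique_set_def)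
  ultimately show ?thesis
    unfolding clique_number_def using assms(2) by (subst Max_le_iff) auto
qed

lemma equitable_coloring_class_ge:
  assumes "equitable_coloring G q c" "i < q"
  shows "card (verts G) div q \<le> card {v \<in> verts G. c v = i}"
proof -
  let ?x = "real (card (verts G)) / real q"
  let ?k = "int (card {v \<in> verts G. c v = i})"
  have "\<forall>i<q. int (card {v \<in> verts G. c v = i}) \<in> {\<lfloor>?x\<rfloor>, \<lceil>?x\<rceil>}"
    using assms(1) unfolding equitable_coloring_def by (rule conjunct2)
  from this[rule_format, OF assms(2)] have "?k = \<lfloor>?x\<rfloor> \<or> ?k = \<lceil>?x\<rceil>"
    by (simp only: insert_iff empty_iff simp_thms)
  then have "\<lfloor>?x\<rfloor> \<le> ?k"
    using floor_le_ceiling[of ?x] by linarith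
  then have "int (card (verts G) div q) \<le> ?k"
    by (simp only: floor_divide_of_nat_eq)
  then show ?thesis by (simp only: of_nat_le_iff)
qed

text \<open>
  The minimum is taken over a nonempty set: giving all vertices different colors is equitable.
\<close>

lemma equitable_chromatic_number_attained:
  assumes "digraph G" "verts G \<noteq> {}"
  obtains c where "equitable_chromatic_number G > 0"
    "equitable_coloring G (equitable_chromatic_number G) c"
proof -
  interpret digraph G by fact
  let ?n = "card (verts G)"
  have n: "?n > 0"
    using assms(2) by (simp add: card_gt_0_iff)
  obtain f where f: "bij_betw f (verts G) {0..<?n}"
    using ex_bij_betw_finite_nat[OF finite_verts] by blast
  have "card {v \<in> verts G. f v = i} = 1" if "i < ?n" for i
  proof -
    have "i \<in> f ` verts G"
      using bij_betw_imp_surj_on[OF f] that by simp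
    then obtain w where "w \<in> verts G" "f w = i"
      by blast
    then have "{v \<in> verts G. f v = i} = {w}"
      using bij_betw_imp_inj_on[OF f] by (blast dest: inj_onD)
    then show ?thesis by simp
  qed
  moreover have "f u \<noteq> f v" if "u \<rightarrow>\<^bsub>G\<^esub> v" for u v
    using f that adj_in_verts[OF that] adj_not_same
    by (metis bij_betw_def inj_on_eq_iff)
  moreover have "f v < ?n" if "v \<in> verts G" for v
    using bij_betwE[OF f] that by simp
  ultimately have "equitable_coloring G ?n f"
    using n by (simp add: equitable_coloring_def proper_coloring_def)
  with n have ex: "\<exists>q. q > 0 \<and> (\<exists>c. equitable_coloring G q c)"
    by blast
  show ?thesis
    using LeastI_ex[OF ex, folded equitable_chromatic_number_def] that by blast
qed

section \<open>A triangle with pendant cliques\<close>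

text \<open>
  The vertices are numbers, and the residue modulo 3 of a vertex is the hub it hangs on. The hubs
  are 0, 1, 2 and the leaves 3, 4, 5. From 6 on, each residue class modulo 12 is one of the twelve
  large pendant cliques, which is consistent because 3 divides 12. \<open>limb\<close> numbers the pendant
  cliques from 3 to 17; a hub is its own limb. The offset 6 is a multiple of 3, so that limb \<open>p\<close>
  hangs on hub \<open>p mod 3\<close>.
\<close>

definition limb :: "nat \<Rightarrow> nat" where
  "limb v = (if v < 6 then v else 6 + v mod 12)"

definition adjacent :: "nat \<Rightarrow> nat \<Rightarrow> bool" where
  "adjacent u v \<longleftrightarrow> u \<noteq> v \<and>
     (u < 3 \<and> v < 3 \<or> limb u = limb v \<or> u = v mod 3 \<or> v = u mod 3)"

definition limbed_triangle :: "nat \<Rightarrow> nat pair_pre_digraph" where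
  "limbed_triangle s = \<lparr>pverts = {..<12 * s + 6},
     parcs = {(u, v). u < 12 * s + 6 \<and> v < 12 * s + 6 \<and> adjacent u v}\<rparr>"

lemma limbed_triangle_simps [simp]:
  "pverts (limbed_triangle s) = {..<12 * s + 6}"
  "parcs (limbed_triangle s) =
     {(u, v). u < 12 * s + 6 \<and> v < 12 * s + 6 \<and> adjacent u v}"
  by (simp_all add: limbed_triangle_def)

lemma limb_mod_3: "limb v mod 3 = v mod 3"
proof -
  have "6 + v mod 12 = v mod 12 + 2 * 3"
    by simp
  then have "(6 + v mod 12) mod 3 = v mod 12 mod 3"
    by (simp only: mod_mult_self1)
  also have "\<dots> = v mod 3"
    by (rule mod_mod_cancel) simp
  finally show ?thesis
    by (cases "v < 6") (simp_all only: limb_def if_True if_False)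
qed

lemma limb_eq_mod_3: "limb u = limb v \<Longrightarrow> u mod 3 = v mod 3"
  by (metis limb_mod_3)

lemma limb_less_18: "limb v < 18"
  by (auto simp: limb_def)

lemma adjacent_from_limb:
  "adjacent u w \<Longrightarrow> u \<ge> 3 \<Longrightarrow> limb w = limb u \<or> w = u mod 3"
  by (auto simp: adjacent_def)

lemma pair_graph_limbed_triangle: "pair_graph (limbed_triangle s)"
proof
  have "parcs (limbed_triangle s) \<subseteq> {..<12 * s + 6} \<times> {..<12 * s + 6}"
    by auto
  then show "finite (parcs (limbed_triangle s))"
    by (rule finite_subset) simp
  show "symmetric (with_proj (limbed_triangle s))"
    by (auto simp: symmetric_def sym_def adjacent_def)
qed (auto simp: adjacent_def)

lemma connected_limbed_triangle:
  "Digraph_Component.connected (with_proj (limbed_triangle s))"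
proof -
  interpret pair_graph "limbed_triangle s"
    by (rule pair_graph_limbed_triangle)
  let ?G = "with_proj (limbed_triangle s)"
  have to_0: "v \<rightarrow>\<^sup>*\<^bsub>?G\<^esub> 0" if v: "v < 12 * s + 6" for v
  proof -
    have "v mod 3 < 3" by simp
    then have hub: "v \<rightarrow>\<^sup>*\<^bsub>?G\<^esub> (v mod 3)"
      using v by (cases "v = v mod 3") (auto intro!: reachable_adjI simp: adjacent_def)
    have "(v mod 3) \<rightarrow>\<^sup>*\<^bsub>?G\<^esub> 0"
      using \<open>v mod 3 < 3\<close>
      by (cases "v mod 3 = 0") (auto intro!: reachable_adjI simp: adjacent_def)
    with hub show ?thesis by (rule reachable_trans)
  qed
  show ?thesis
  proof (rule connectedI)
    fix u v assume "u \<in> pverts (limbed_triangle s)" "v \<in> pverts (limbed_triangle s)"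
    then have "u \<rightarrow>\<^sup>*\<^bsub>?G\<^esub> 0" "0 \<rightarrow>\<^sup>*\<^bsub>?G\<^esub> v"
      using to_0 by (simp_all add: symmetric_reachable')
    then have "u \<rightarrow>\<^sup>*\<^bsub>?G\<^esub> v"
      by (rule reachable_trans)
    then show "u \<rightarrow>\<^sup>*\<^bsub>mk_symmetric ?G\<^esub> v"
      by (rule reachable_mk_symmetricI)
  qed (simp add: lessThan_empty_iff)
qed

text \<open>
  A connected subgraph without cut vertex that meets a limb cannot leave the limb and its hub,
  since the hub would separate the vertices on both sides; if it meets no limb, it lies in the
  triangle.
\<close>

lemma block_graph_limbed_triangle: "block_graph (with_proj (limbed_triangle s))"
proof (rule block_graphI)
  let ?G = "with_proj (limbed_triangle s)"
  show "Digraph.graph ?G"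
    using pair_graph_limbed_triangle by (rule pair_graph.pair_graphD_graph)
  fix H assume sub: "subgraph H ?G" and H: "Digraph.graph H" "Digraph_Component.connected H"
    and no_cut: "\<forall>v. \<not> cut_vertex H v"
  have V: "verts H \<subseteq> {..<12 * s + 6}"
    using subgraph_imp_subverts[OF sub] by simp
  have adj: "adjacent u w" if "u \<rightarrow>\<^bsub>H\<^esub> w" for u w
    using arcs_ends_mono[OF sub] that by auto
  show "clique_set ?G (verts H)"
  proof (cases "verts H \<subseteq> {..<3}")
    case True
    then show ?thesis
      using V by (auto simp: clique_set_def adjacent_def)
  next
    case False
    then obtain x where x: "x \<in> verts H" "x \<ge> 3"
      by force
    have x_S: "x \<in> {v. limb v = limb x}" by simp
    have limb3: "u \<ge> 3" if "limb u = limb x" for u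
      using that x(2) by (auto simp: limb_def split: if_splits)
    have in_limb: "limb y = limb x \<or> y = x mod 3" if y: "y \<in> verts H" for y
    proof (rule ccontr)
      assume n: "\<not> (limb y = limb x \<or> y = x mod 3)"
      have "x mod 3 \<notin> {v. limb v = limb x}"
        using limb3[of "x mod 3"] by (auto simp: not_le)
      moreover have "w \<in> {v. limb v = limb x} \<or> w = x mod 3"
        if "u \<rightarrow>\<^bsub>H\<^esub> w" "u \<in> {v. limb v = limb x}" for u w
      proof -
        have u: "limb u = limb x"
          using that(2) by simp
        show ?thesis
          using adjacent_from_limb[OF adj[OF that(1)] limb3[OF u]] u limb_eq_mod_3[OF u] by simp
      qed
      ultimately have "cut_vertex H (x mod 3)"
        using n by (intro cut_vertex_if_gate[OF H x(1) x_S y]) auto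
      with no_cut show False by blast
    qed
    have "adjacent u w" if "u \<in> verts H" "w \<in> verts H" "u \<noteq> w" for u w
      using in_limb[OF that(1)] in_limb[OF that(2)] that(3) limb_eq_mod_3[of u x]
        limb_eq_mod_3[of w x] unfolding adjacent_def by metis
    then show ?thesis
      using V by (auto simp: clique_set_def)
  qed
qed

lemma card_limb_le:
  assumes "s \<ge> 1" "x \<ge> 3"
  shows "card {v. v < 12 * s + 6 \<and> limb v = limb x} \<le> s"
proof (cases "x < 6")
  case True
  then have "{v. v < 12 * s + 6 \<and> limb v = limb x} \<subseteq> {x}"
    by (auto simp: limb_def split: if_splits)
  then have "card {v. v < 12 * s + 6 \<and> limb v = limb x} \<le> card {x}"
    by (intro card_mono) auto
  with assms(1) show ?thesis by simp
next
  case False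
  let ?L = "{v. v < 12 * s + 6 \<and> limb v = limb x}"
  have L: "6 \<le> v \<and> v mod 12 = x mod 12" if "v \<in> ?L" for v
    using that False by (auto simp: limb_def split: if_splits)
  \<comment> \<open>Shifted by 6, the vertices from 6 on fill the rounds 1 to \<open>s\<close> of length 12.\<close>
  have "inj_on (\<lambda>v. (v + 6) div 12) ?L"
  proof (rule inj_onI)
    fix v w assume vw: "v \<in> ?L" "w \<in> ?L" and d: "(v + 6) div 12 = (w + 6) div 12"
    have "(v + 6) mod 12 = (w + 6) mod 12"
      using L[OF vw(1)] L[OF vw(2)] by (intro mod_add_cong) auto
    with d have "v + 6 = w + 6"
      by (metis div_mult_mod_eq)
    then show "v = w" by simp
  qed
  moreover have "(\<lambda>v. (v + 6) div 12) ` ?L \<subseteq> {1..s}"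
  proof
    fix d assume "d \<in> (\<lambda>v. (v + 6) div 12) ` ?L"
    then obtain v where v: "v < 12 * s + 6" "v \<ge> 6" "d = (v + 6) div 12"
      using L by blast
    then show "d \<in> {1..s}"
      using less_mult_imp_div_less[of "v + 6" "Suc s" 12] div_le_mono[of 12 "v + 6" 12] by simp
  qed
  ultimately have "card ?L \<le> card {1..s}"
    by (intro card_inj_on_le) auto
  then show ?thesis by simp
qed

lemma clique_number_limbed_triangle_le:
  assumes "s \<ge> 2"
  shows "clique_number (with_proj (limbed_triangle s)) \<le> s + 1"
proof (rule clique_number_le)
  fix K assume K: "clique_set (with_proj (limbed_triangle s)) K"
  show "card K \<le> s + 1"
  proof (cases "K \<subseteq> {..<3}")
    case True
    then have "card K \<le> card {..<3::nat}"
      by (intro card_mono) auto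
    with assms show ?thesis by simp
  next
    case False
    then obtain x where x: "x \<in> K" "x \<ge> 3" by force
    let ?L = "{v. v < 12 * s + 6 \<and> limb v = limb x}"
    have "K \<subseteq> insert (x mod 3) ?L"
    proof
      fix y assume "y \<in> K"
      then show "y \<in> insert (x mod 3) ?L"
        using K x adjacent_from_limb[of x y] by (cases "x = y") (auto simp: clique_set_def)
    qed
    then have "card K \<le> card (insert (x mod 3) ?L)"
      by (intro card_mono) auto
    also have "\<dots> \<le> s + 1"
      using card_limb_le[of s x] assms x(2) by (simp add: card_insert_if)
    finally show ?thesis .
  qed
qed auto

text \<open>
  One vertex from each of the ten pendant cliques at the two other hubs can be added to \<open>v\<close>,
  whether \<open>v\<close> is a hub or lies in a limb. The vertices 3 to 17 are representatives of the limbs.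
\<close>

lemma alpha_min_limbed_triangle_ge:
  assumes "s \<ge> 1"
  shows "alpha_min (with_proj (limbed_triangle s)) \<ge> 11"
proof -
  let ?G = "with_proj (limbed_triangle s)"
  have "alpha_at ?G v \<ge> 11" if v: "v < 12 * s + 6" for v
  proof -
    let ?J = "{w \<in> {3..<18}. w mod 3 \<noteq> v mod 3}"
    have J: "?J = set (filter (\<lambda>w. w mod 3 \<noteq> v mod 3) [3..<18])"
      by (simp only: set_filter set_upt)
    have "card ?J = length (filter (\<lambda>w. w mod 3 \<noteq> v mod 3) [3..<18])"
      unfolding J by (rule distinct_card) (simp only: distinct_filter distinct_upt)
    moreover have "v mod 3 = 0 \<or> v mod 3 = 1 \<or> v mod 3 = 2"
      by linarith
    ultimately have "card ?J = 10"
      by (elim disjE) (simp_all add: upt_rec_numeral)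
    then have "card (insert v ?J) = 11" by simp
    moreover have "independent_set ?G (insert v ?J)"
    proof -
      have *: "\<not> adjacent v w" "\<not> adjacent w v" if "w \<in> ?J" for w
        using that limb_eq_mod_3[of v w] by (auto simp: adjacent_def)
      have mod12: "u mod 12 = (if u < 12 then u else u - 12)" if "u < 18" for u :: nat
        using that by (simp add: le_mod_geq)
      have "limb u \<noteq> limb w" if "u \<in> {3..<18}" "w \<in> {3..<18}" "u \<noteq> w" for u w
        using that mod12[of u] mod12[of w] by (auto simp: limb_def split: if_splits)
      then have "\<not> adjacent u w" if "u \<in> ?J" "w \<in> ?J" for u w
        using that by (auto simp: adjacent_def)
      with * show ?thesis
        using v assms by (auto simp: independent_set_def adjacent_def)
    qed
    ultimately show ?thesis
      using card_independent_le_alpha_at[of ?G "insert v ?J" v] by simp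
  qed
  then show ?thesis
    unfolding alpha_min_def by (subst Min_ge_iff) (auto simp: lessThan_empty_iff)
qed

lemma lower_bound_limbed_triangle_le:
  assumes "s \<ge> 2"
  shows "lower_bound (with_proj (limbed_triangle s)) \<le> s + 1"
proof -
  let ?a = "real (alpha_min (with_proj (limbed_triangle s)))"
  have "?a \<ge> 11"
    using alpha_min_limbed_triangle_ge[of s] assms by simp
  then have "(real s + 1) * (?a + 1) \<ge> (real s + 1) * 12"
    by (intro mult_left_mono) auto
  then have "(real (12 * s + 6) + 1) / (?a + 1) \<le> real s + 1"
    using \<open>?a \<ge> 11\<close> by (simp add: divide_le_eq)
  then have "nat \<lceil>(real (12 * s + 6) + 1) / (?a + 1)\<rceil> \<le> s + 1"
    by (simp add: nat_le_iff ceiling_le_iff)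
  with clique_number_limbed_triangle_le[OF assms] show ?thesis
    by (simp add: lower_bound_def)
qed

section \<open>Equitable colorings\<close>

text \<open>
  The vertices are counted limb by limb: a large limb shows each color at most once and not the
  color of its hub, so it has at most two vertices in the three classes, while a hub or
  a leaf is a single vertex.
\<close>

lemma card_three_hub_classes_le:
  assumes "proper_coloring (with_proj (limbed_triangle s)) q c"
  shows "card {v \<in> {..<12 * s + 6}. c v \<in> c ` {..<3}} \<le> 30"
proof -
  let ?A = "{v \<in> {..<12 * s + 6}. c v \<in> c ` {..<3}}"
  have proper: "c u \<noteq> c v" if "u < 12 * s + 6" "v < 12 * s + 6" "adjacent u v" for u v
    using assms that by (auto simp: proper_coloring_def)
  have leaf: "card {v \<in> ?A. limb v = p} \<le> 1" if "p < 6" for p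
  proof -
    have "{v \<in> ?A. limb v = p} \<subseteq> {p}"
      using that by (auto simp: limb_def split: if_splits)
    then have "card {v \<in> ?A. limb v = p} \<le> card {p}"
      by (intro card_mono) auto
    then show ?thesis by simp
  qed
  have big: "card {v \<in> ?A. limb v = p} \<le> 2" if "6 \<le> p" for p
  proof -
    have "inj_on c {v \<in> ?A. limb v = p}"
      using proper by (intro inj_onI) (auto simp: adjacent_def)
    moreover have "c ` {v \<in> ?A. limb v = p} \<subseteq> c ` ({..<3} - {p mod 3})"
    proof
      fix i assume "i \<in> c ` {v \<in> ?A. limb v = p}"
      then obtain v h where v: "v < 12 * s + 6" "limb v = p" "i = c v" and h: "h < 3" "c v = c h"
        by auto
      have "v \<ge> 6" "v mod 3 = p mod 3"
        using v(2) that limb_mod_3[of v] by (auto simp: limb_def split: if_splits)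
      then have "h \<noteq> p mod 3"
        using proper[of v h] v(1) h by (auto simp: adjacent_def)
      with v h show "i \<in> c ` ({..<3} - {p mod 3})" by auto
    qed
    ultimately have "card {v \<in> ?A. limb v = p} \<le> card (c ` ({..<3} - {p mod 3}))"
      by (intro card_inj_on_le) auto
    also have "\<dots> \<le> card ({..<3} - {p mod 3})"
      by (rule card_image_le) simp
    also have "\<dots> = 2" by simp
    finally show ?thesis .
  qed
  have "?A = (\<Union>p\<in>{..<18}. {v \<in> ?A. limb v = p})"
    using limb_less_18 by auto
  then have "card ?A = card (\<Union>p\<in>{..<18}. {v \<in> ?A. limb v = p})"
    by (rule arg_cong)
  also have "\<dots> \<le> (\<Sum>p<18. card {v \<in> ?A. limb v = p})"
    by (rule card_UN_le) simp
  also have "\<dots> \<le> (\<Sum>p<18::nat. if p < 6 then 1 else 2)"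
    using leaf big by (intro sum_mono) auto
  also have "\<dots> = 30"
    by (simp add: numeral_eq_Suc)
  finally show ?thesis .
qed

text \<open>
  Otherwise every class has at least 11 vertices, and the classes of the three hubs would have 33
  vertices in total instead of at most 30.
\<close>

lemma equitable_coloring_needs_many_colors:
  assumes "equitable_coloring (with_proj (limbed_triangle s)) q c" "q > 0"
  shows "12 * s + 6 < 11 * q"
proof (rule ccontr)
  let ?G = "with_proj (limbed_triangle s)"
  let ?class = "\<lambda>i. {v \<in> {..<12 * s + 6}. c v = i}"
  assume "\<not> 12 * s + 6 < 11 * q"
  then have "11 \<le> (12 * s + 6) div q"
    using assms(2) by (simp add: less_eq_div_iff_mult_less_eq)
  then have ge: "11 \<le> card (?class i)" if "i < q" for i
    using equitable_coloring_class_ge[OF assms(1) that] by simp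
  have proper: "proper_coloring ?G q c"
    using assms(1) by (simp add: equitable_coloring_def)
  then have inj: "inj_on c {..<3}" and less: "c ` {..<3} \<subseteq> {..<q}"
    by (auto simp: proper_coloring_def inj_on_def adjacent_def) force
  have "33 = (\<Sum>i\<in>c ` {..<3}. 11 :: nat)"
    using inj by (simp add: card_image)
  also have "\<dots> \<le> (\<Sum>i\<in>c ` {..<3}. card (?class i))"
    using ge less by (intro sum_mono) auto
  also have "\<dots> = card (\<Union>i\<in>c ` {..<3}. ?class i)"
    by (rule card_UN_disjoint[symmetric]) auto
  also have "(\<Union>i\<in>c ` {..<3}. ?class i) = {v \<in> {..<12 * s + 6}. c v \<in> c ` {..<3}}"
    by auto
  also have "card \<dots> \<le> 30"
    using proper by (rule card_three_hub_classes_le)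
  finally show False by simp
qed

theorem corollary3:
  fixes C :: int
  shows "\<exists>G :: nat pair_pre_digraph.
           pair_graph G \<and> Digraph_Component.connected G \<and> block_graph G \<and>
           int (equitable_chromatic_number G) - int (lower_bound G) > C"
proof -
  \<comment> \<open>For \<open>q \<le> s + 1 + C\<close> the inequality \<open>12 * s + 6 < 11 * q\<close> would give
    \<open>s < 11 * C + 5\<close>.\<close>
  define s where "s = 11 * nat C + 5"
  let ?G = "limbed_triangle s"
  have "digraph (with_proj ?G)"
    using pair_graph.pair_graphD_graph[OF pair_graph_limbed_triangle] by (rule Digraph.graph.axioms)
  then obtain c where "equitable_coloring ?G (equitable_chromatic_number ?G) c"
    and "equitable_chromatic_number ?G > 0"
    by (rule equitable_chromatic_number_attained) (simp add: lessThan_empty_iff)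
  then have "12 * s + 6 < 11 * equitable_chromatic_number ?G"
    by (rule equitable_coloring_needs_many_colors)
  moreover have "lower_bound ?G \<le> s + 1"
    by (rule lower_bound_limbed_triangle_le) (simp add: s_def)
  ultimately have "int (equitable_chromatic_number ?G) - int (lower_bound ?G) > C"
    by (simp add: s_def)
  then show ?thesis
    using pair_graph_limbed_triangle connected_limbed_triangle block_graph_limbed_triangle
    by blast
qed

end
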